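(* Let $t>0$ and let $T=(T_1,\dots,T_\ell)$ be a random vector in $\mathbb{R}^\ell$ with an absolutely continuous spherical distribution, i.e. with a density of the form $f(x)=g(\|x\|^2)$, $x\in\mathbb{R}^\ell$; assume furthermore that $g$ is non-increasing. For $s=(s_1,\dots,s_\ell)^\top\in\mathbb{R}^\ell$ and $\delta=(\delta_1,\dots,\delta_\ell)^\top\in\mathbb{R}_+^\ell$ let $F_t(s,\delta)=\mathbb{P}\big(\sum_{i=1}^\ell\delta_i(T_i+s_i)^2\le t\big)$. Then $$\big((0,\dots,0),(1,\dots,1)\big)\in\underset{(s,\delta)\in\mathbb{R}^\ell\times\mathbb{R}_+^\ell,\ \prod_i\delta_i=1}{\arg\max}F_t(s,\delta).$$ In particular, let $\alpha\in(0,1)$ and let $R_1$ be a random vector in $\mathbb{R}^\ell$ with finite second moments and density $f(r)\propto g((r-\mu)^\top\boldsymbol\Sigma^{-1}(r-\mu))$, where $\mu\in\mathbb{R}^\ell$, $\boldsymbol\Sigma=\mathrm{Cov}(R_1)$ is positive definite and $g:\mathbb{R}_+\to\mathbb{R}_+$ is non-increasing. Then, with $\mathcal E_\alpha^\infty$ (taken with $k=0$, $\lambda=0$) and $\mathcal B_\alpha^\infty$ as defined in the context, $\mathrm{Vol}(\mathcal E_\alpha^\infty)\le\mathrm{Vol}(\mathcal B_\alpha^\infty)$.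
   Context: $\|\cdot\|$ is the Euclidean norm; $\mathrm{Vol}$ is Lebesgue measure on $\mathbb{R}^\ell$; $q_{1-\alpha}(\xi)=\inf\{r\in\mathbb{R}:\mathbb{P}(\xi>r)\le\alpha\}$. In the case $k=0$, $\lambda=0$ (no explanatory variable $X$, no ridge), the asymptotic ellipsoid is $$\mathcal E_\alpha^\infty=\{z\in\mathbb{R}^\ell:(z-\mathbb{E}[R_1])^\top\boldsymbol\Sigma^{-1}(z-\mathbb{E}[R_1])\le q_{1-\alpha}\big((R_1-\mathbb{E}[R_1])^\top\boldsymbol\Sigma^{-1}(R_1-\mathbb{E}[R_1])\big)\},$$ and $\mathcal B_\alpha^\infty$ is the ball of $\mathbb{R}^\ell$ centered at $0$ with squared radius $q_{1-\alpha}(\|R_1\|^2)$. *)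

theory Defs
  imports "HOL-Probability.Probability"
begin

definition covariance_matrix :: "'a measure \<Rightarrow> ('a \<Rightarrow> real ^ 'n) \<Rightarrow> real ^ 'n ^ 'n" where
  "covariance_matrix M R =
     (\<chi> i j. prob_space.expectation M
        (\<lambda>\<omega>. (R \<omega> $ i - prob_space.expectation M (\<lambda>\<omega>. R \<omega> $ i)) *
             (R \<omega> $ j - prob_space.expectation M (\<lambda>\<omega>. R \<omega> $ j))))"

definition pos_def_matrix :: "real ^ 'n ^ 'n \<Rightarrow> bool" where
  "pos_def_matrix A \<longleftrightarrow> transpose A = A \<and> (\<forall>v. v \<noteq> 0 \<longrightarrow> v \<bullet> (A *v v) > 0)"

definition inv_quad_form :: "real ^ 'n ^ 'n \<Rightarrow> real ^ 'n \<Rightarrow> real" where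
  "inv_quad_form A v = v \<bullet> (matrix_inv A *v v)"

text \<open>The level \<open>\<alpha>\<close> is the mass of the upper tail, so this is the quantile of
  order \<open>1 - \<alpha>\<close>. For \<open>0 < \<alpha> < 1\<close> and a real random variable \<open>\<xi>\<close> the set is nonempty and
  bounded below, so that the infimum is the intended one.\<close>

definition upper_quantile :: "'a measure \<Rightarrow> real \<Rightarrow> ('a \<Rightarrow> real) \<Rightarrow> real" where
  "upper_quantile M \<alpha> \<xi> = Inf {r. measure M {\<omega> \<in> space M. \<xi> \<omega> > r} \<le> \<alpha>}"

definition F_prob ::
  "'a measure \<Rightarrow> ('a \<Rightarrow> real ^ 'n) \<Rightarrow> real \<Rightarrow> real ^ 'n \<Rightarrow> real ^ 'n \<Rightarrow> real" where
  "F_prob M T t s \<delta> =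
     measure M {\<omega> \<in> space M. (\<Sum>i\<in>UNIV. \<delta> $ i * (T \<omega> $ i + s $ i)\<^sup>2) \<le> t}"

definition asymptotic_ellipsoid ::
  "'a measure \<Rightarrow> ('a \<Rightarrow> real ^ 'n) \<Rightarrow> real \<Rightarrow> (real ^ 'n) set" where
  "asymptotic_ellipsoid M R \<alpha> =
     (let m = prob_space.expectation M R; S = covariance_matrix M R
      in {z. inv_quad_form S (z - m) \<le> upper_quantile M \<alpha> (\<lambda>\<omega>. inv_quad_form S (R \<omega> - m))})"

definition asymptotic_ball ::
  "'a measure \<Rightarrow> ('a \<Rightarrow> real ^ 'n) \<Rightarrow> real \<Rightarrow> (real ^ 'n) set" where
  "asymptotic_ball M R \<alpha> = cball 0 (sqrt (upper_quantile M \<alpha> (\<lambda>\<omega>. (norm (R \<omega>))\<^sup>2)))"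

end

theory Submission
  imports Defs
begin

text \<open>
  Both claims rest on one fact about densities: among all sets of at most a given volume, a
  superlevel set \<open>E\<close> of that volume captures the most mass. Superlevel set means here that the
  density is at least some \<open>c\<close> on \<open>E\<close> and at most \<open>c\<close> outside, so plateaus of the density
  may be cut. Replacing \<open>A - E\<close> by the at least as voluminous \<open>E - A\<close> trades
  mass of density at most \<open>c\<close> for mass of density at least \<open>c\<close> (\<open>prob_le_superlevel_set\<close>).

  For the spherical vector \<open>T\<close>, the event in \<open>F_prob\<close> says that \<open>T\<close> lies in an
  ellipsoid. The constraint \<open>\<Prod>\<delta>\<^sub>i = 1\<close> says precisely that this ellipsoid has the volume of
  the centred ball of radius \<open>\<surd>t\<close>, and that ball is a superlevel set of the density because
  \<open>g\<close> is non-increasing.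

  The second claim reads the same fact backwards. Reflection in \<open>\<mu>\<close> preserves the density of
  \<open>R\<close>, so the mean is \<open>\<mu>\<close> and the ellipsoids centred at the mean are superlevel sets of the
  density. The ball is a set of probability at least \<open>1 - \<alpha>\<close>, whereas every ellipsoid
  of a level strictly below the quantile has probability less than \<open>1 - \<alpha>\<close> and hence, by the
  fact above, less volume than the ball. Volumes of concentric ellipsoids scale continuously, so
  the inequality passes to the ellipsoid at the quantile itself
  (\<open>highest_density_region_minimal_volume\<close>).
\<close>

section \<open>Superlevel sets of a density\<close>

text \<open>The common part \<open>A \<inter> E\<close> contributes equally to both sides. Since it has finite measure, it
  can also be cancelled from the assumed inequality of measures, so \<open>A - E\<close> is no larger than
  \<open>E - A\<close>; comparing both integrals with the constant \<open>c\<close> concludes.\<close>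

lemma nn_integral_le_superlevel_set:
  fixes f :: "'a \<Rightarrow> ennreal"
  assumes [measurable]: "f \<in> borel_measurable N" "A \<in> sets N" "E \<in> sets N"
    and fin: "emeasure N A < \<infinity>" and le: "emeasure N A \<le> emeasure N E"
    and ge: "\<And>x. x \<in> E \<Longrightarrow> c \<le> f x" and off: "\<And>x. x \<notin> E \<Longrightarrow> f x \<le> c"
  shows "(\<integral>\<^sup>+x. f x * indicator A x \<partial>N) \<le> (\<integral>\<^sup>+x. f x * indicator E x \<partial>N)"
proof -
  have split: "(\<integral>\<^sup>+x. f x * indicator X x \<partial>N) =
      (\<integral>\<^sup>+x. f x * indicator (A \<inter> E) x \<partial>N) + (\<integral>\<^sup>+x. f x * indicator (X - Y) x \<partial>N)"
    if "X \<inter> Y = A \<inter> E" "X \<in> sets N" "Y \<in> sets N" for X Y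
  proof -
    note [measurable] = that(2,3)
    have "f x * indicator X x = f x * indicator (A \<inter> E) x + f x * indicator (X - Y) x" for x
      using that(1) by (auto simp: indicator_def)
    then show ?thesis by (simp add: nn_integral_add)
  qed
  have "emeasure N (A \<inter> E) + emeasure N (A - E) = emeasure N A"
    by (subst plus_emeasure) (auto intro!: arg_cong[of _ _ "emeasure N"])
  moreover have "emeasure N (A \<inter> E) + emeasure N (E - A) = emeasure N E"
    by (subst plus_emeasure) (auto intro!: arg_cong[of _ _ "emeasure N"])
  moreover have "emeasure N (A \<inter> E) < \<infinity>"
    using fin by (meson assms(2) emeasure_mono inf_le1 le_less_trans)
  ultimately have diff_le: "emeasure N (A - E) \<le> emeasure N (E - A)"
    using le by (metis ennreal_add_left_cancel_le infinity_ennreal_def order_less_irrefl)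
  have "(\<integral>\<^sup>+x. f x * indicator (A - E) x \<partial>N) \<le> (\<integral>\<^sup>+x. c * indicator (A - E) x \<partial>N)"
    by (intro nn_integral_mono) (auto simp: indicator_def off)
  also have "\<dots> = c * emeasure N (A - E)"
    by (simp add: nn_integral_cmult_indicator)
  also have "\<dots> \<le> c * emeasure N (E - A)"
    using diff_le by (rule mult_left_mono) simp
  also have "\<dots> = (\<integral>\<^sup>+x. c * indicator (E - A) x \<partial>N)"
    by (simp add: nn_integral_cmult_indicator)
  also have "\<dots> \<le> (\<integral>\<^sup>+x. f x * indicator (E - A) x \<partial>N)"
    by (intro nn_integral_mono) (auto simp: indicator_def ge)
  finally show ?thesis
    using split[of A E] split[of E A] by (simp add: Int_commute add_left_mono)
qed

section \<open>Quantiles\<close>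

context prob_space
begin

lemma tail_level_nonneg:
  fixes \<xi> :: "'a \<Rightarrow> real"
  assumes nonneg: "\<And>\<omega>. 0 \<le> \<xi> \<omega>" and "\<alpha> < 1"
    and r: "prob {\<omega> \<in> space M. \<xi> \<omega> > r} \<le> \<alpha>"
  shows "0 \<le> r"
proof (rule ccontr)
  assume "\<not> 0 \<le> r"
  then have "{\<omega> \<in> space M. \<xi> \<omega> > r} = space M"
    using nonneg by (auto simp: not_le intro: less_le_trans[of r 0])
  with r \<open>\<alpha> < 1\<close> show False by (simp add: prob_space)
qed

text \<open>The tail probability is right-continuous, so it is at most \<open>\<alpha>\<close> at the quantile itself,
  while it exceeds \<open>\<alpha>\<close> at every smaller level. The assumptions on \<open>\<xi>\<close> and \<open>\<alpha>\<close> make the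
  set of admissible levels nonempty and bounded below, without which the infimum would be
  arbitrary.\<close>

lemma upper_quantile_properties:
  assumes [measurable]: "\<xi> \<in> borel_measurable M" and nonneg: "\<And>\<omega>. 0 \<le> \<xi> \<omega>"
    and \<alpha>: "0 < \<alpha>" "\<alpha> < 1"
  shows upper_quantile_nonneg: "0 \<le> upper_quantile M \<alpha> \<xi>"
    and prob_le_upper_quantile: "1 - \<alpha> \<le> prob {\<omega> \<in> space M. \<xi> \<omega> \<le> upper_quantile M \<alpha> \<xi>}"
    and prob_le_below_upper_quantile:
      "\<And>r. r < upper_quantile M \<alpha> \<xi> \<Longrightarrow> prob {\<omega> \<in> space M. \<xi> \<omega> \<le> r} < 1 - \<alpha>"
proof -
  define L where "L = {r. prob {\<omega> \<in> space M. \<xi> \<omega> > r} \<le> \<alpha>}"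
  define q where "q = upper_quantile M \<alpha> \<xi>"
  have q: "q = Inf L" by (simp add: q_def L_def upper_quantile_def)
  have L0: "0 \<le> r" if "r \<in> L" for r
    using tail_level_nonneg[of \<xi>, OF nonneg \<alpha>(2)] that by (simp add: L_def)
  have bdd: "bdd_below L" using L0 by (intro bdd_belowI)
  have compl: "prob {\<omega> \<in> space M. \<xi> \<omega> \<le> r} = 1 - prob {\<omega> \<in> space M. \<xi> \<omega> > r}" for r
  proof -
    have "{\<omega> \<in> space M. \<xi> \<omega> \<le> r} = space M - {\<omega> \<in> space M. \<xi> \<omega> > r}" by auto
    then show ?thesis by (simp add: prob_compl)
  qed
  \<comment> \<open>Some level is admissible because the tail probabilities vanish at infinity.\<close>
  have "(\<lambda>n. prob {\<omega> \<in> space M. \<xi> \<omega> > real n}) \<longlonglongrightarrow>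
      prob (\<Inter>n. {\<omega> \<in> space M. \<xi> \<omega> > real n})"
    by (rule finite_Lim_measure_decseq) (auto simp: decseq_def)
  also have "(\<Inter>n. {\<omega> \<in> space M. \<xi> \<omega> > real n}) = {}"
    by auto (meson less_asym reals_Archimedean2)
  finally have "eventually (\<lambda>n. prob {\<omega> \<in> space M. \<xi> \<omega> > real n} < \<alpha>) sequentially"
    using \<alpha>(1) by (intro order_tendstoD(2)) auto
  then have "L \<noteq> {}"
    unfolding L_def eventually_sequentially by (auto intro: less_imp_le)
  then show "0 \<le> upper_quantile M \<alpha> \<xi>"
    using L0 unfolding q_def[symmetric] q by (intro cInf_greatest)
  show "prob {\<omega> \<in> space M. \<xi> \<omega> \<le> r} < 1 - \<alpha>" if "r < upper_quantile M \<alpha> \<xi>" for r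
  proof -
    have "r \<notin> L" using that bdd cInf_lower[of r L] unfolding q_def[symmetric] q by auto
    then show ?thesis unfolding compl by (simp add: L_def)
  qed
  have above: "prob {\<omega> \<in> space M. \<xi> \<omega> > r} \<le> \<alpha>" if less: "q < r" for r
  proof -
    obtain x where x: "x \<in> L" "x < r"
      using \<open>L \<noteq> {}\<close> bdd less cInf_less_iff[of L r] unfolding q by auto
    have "prob {\<omega> \<in> space M. \<xi> \<omega> > r} \<le> prob {\<omega> \<in> space M. \<xi> \<omega> > x}"
      using x(2) by (intro finite_measure_mono) auto
    with x(1) show ?thesis by (simp add: L_def)
  qed
  \<comment> \<open>The tail event at \<open>q\<close> is the increasing union of tail events at levels above \<open>q\<close>.\<close>
  have "(\<lambda>n. prob {\<omega> \<in> space M. \<xi> \<omega> > q + 1 / real (Suc n)}) \<longlonglongrightarrow>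
      prob (\<Union>n. {\<omega> \<in> space M. \<xi> \<omega> > q + 1 / real (Suc n)})"
  proof (rule finite_Lim_measure_incseq)
    show "incseq (\<lambda>n. {\<omega> \<in> space M. \<xi> \<omega> > q + 1 / real (Suc n)})"
    proof (intro incseq_SucI subsetI)
      fix n x assume "x \<in> {\<omega> \<in> space M. \<xi> \<omega> > q + 1 / real (Suc n)}"
      moreover have "1 / real (Suc (Suc n)) \<le> 1 / real (Suc n)" by (simp add: frac_le)
      ultimately show "x \<in> {\<omega> \<in> space M. \<xi> \<omega> > q + 1 / real (Suc (Suc n))}" by simp
    qed
  qed auto
  moreover have "(\<Union>n. {\<omega> \<in> space M. \<xi> \<omega> > q + 1 / real (Suc n)}) = {\<omega> \<in> space M. \<xi> \<omega> > q}"
  proof (intro set_eqI iffI)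
    fix x assume "x \<in> {\<omega> \<in> space M. \<xi> \<omega> > q}"
    then obtain n where "inverse (real (Suc n)) < \<xi> x - q" "x \<in> space M"
      using reals_Archimedean[of "\<xi> x - q"] by auto
    then show "x \<in> (\<Union>n. {\<omega> \<in> space M. \<xi> \<omega> > q + 1 / real (Suc n)})"
      by (intro UN_I[of n]) (auto simp: inverse_eq_divide)
  next
    fix x assume "x \<in> (\<Union>n. {\<omega> \<in> space M. \<xi> \<omega> > q + 1 / real (Suc n)})"
    then obtain n where "x \<in> space M" "\<xi> x > q + 1 / real (Suc n)" by auto
    moreover have "0 < 1 / real (Suc n)" by simp
    ultimately have "q < \<xi> x" by linarith
    with \<open>x \<in> space M\<close> show "x \<in> {\<omega> \<in> space M. \<xi> \<omega> > q}" by simp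
  qed
  ultimately have "prob {\<omega> \<in> space M. \<xi> \<omega> > q} \<le> \<alpha>"
    by (intro LIMSEQ_le_const2[where X = "\<lambda>n. prob {\<omega> \<in> space M. \<xi> \<omega> > q + 1 / real (Suc n)}"])
       (auto intro!: above)
  then show "1 - \<alpha> \<le> prob {\<omega> \<in> space M. \<xi> \<omega> \<le> upper_quantile M \<alpha> \<xi>}"
    unfolding q_def[symmetric] compl by simp
qed

section \<open>Highest-density regions\<close>

lemma prob_le_superlevel_set:
  fixes T :: "'a \<Rightarrow> 'b::euclidean_space"
  assumes D: "distributed M lborel T f"
    and [measurable]: "A \<in> sets borel" "E \<in> sets borel"
    and fin: "emeasure lborel A < \<infinity>" and le: "emeasure lborel A \<le> emeasure lborel E"
    and ge: "\<And>x. x \<in> E \<Longrightarrow> c \<le> f x" and off: "\<And>x. x \<notin> E \<Longrightarrow> f x \<le> c"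
  shows "prob (T -` A \<inter> space M) \<le> prob (T -` E \<inter> space M)"
proof -
  have [measurable]: "f \<in> borel_measurable lborel"
    using D by (simp add: distributed_def)
  have "emeasure M (T -` A \<inter> space M) \<le> emeasure M (T -` E \<inter> space M)"
    using nn_integral_le_superlevel_set[OF _ _ _ fin le ge off]
    by (simp add: distributed_emeasure[OF D])
  then show ?thesis by (simp add: emeasure_eq_measure)
qed

text \<open>Highest-density regions are the smallest ones with given coverage. A region at a level
  \<open>s\<close> below the quantile has too little probability to be as large as \<open>B\<close>. The level cannot be
  taken equal to the quantile in this argument, since there both probabilities may be equal;
  homogeneity of \<open>Q\<close> makes the volume continuous in the level and closes the gap.\<close>

lemma highest_density_region_minimal_volume:
  fixes R :: "'a \<Rightarrow> 'b::euclidean_space" and Q :: "'b \<Rightarrow> real" and g :: "real \<Rightarrow> real"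
  assumes D: "distributed M lborel R (\<lambda>x. ennreal (g (Q (x - m))))"
    and g: "antimono_on {0..} g"
    and [measurable]: "Q \<in> borel_measurable borel"
    and Q_nonneg: "\<And>v. 0 \<le> Q v" and Q_zero: "\<And>v. Q v = 0 \<Longrightarrow> v = 0"
    and Q_scale: "\<And>a v. Q (a *\<^sub>R v) = a\<^sup>2 * Q v"
    and \<alpha>: "0 < \<alpha>" "\<alpha> < 1"
    and B[measurable]: "B \<in> sets borel" and prob_B: "1 - \<alpha> \<le> prob (R -` B \<inter> space M)"
  shows "emeasure lborel {z. Q (z - m) \<le> upper_quantile M \<alpha> (\<lambda>\<omega>. Q (R \<omega> - m))}
         \<le> emeasure lborel B"
proof -
  define r where "r = upper_quantile M \<alpha> (\<lambda>\<omega>. Q (R \<omega> - m))"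
  define E where "E s = {z. Q (z - m) \<le> s}" for s
  have [measurable]: "R \<in> borel_measurable M"
    using D by (simp add: distributed_def)
  have E_sets[measurable]: "E s \<in> sets borel" for s
    unfolding E_def by measurable
  have r0: "0 \<le> r"
    unfolding r_def by (rule upper_quantile_nonneg) (auto simp: Q_nonneg \<alpha>)
  have shrunk: "emeasure lborel (E s) \<le> emeasure lborel B" if s: "0 \<le> s" "s < r" for s
  proof (rule ccontr)
    assume "\<not> emeasure lborel (E s) \<le> emeasure lborel B"
    then have less: "emeasure lborel B < emeasure lborel (E s)" by simp
    have "prob (R -` B \<inter> space M) \<le> prob (R -` E s \<inter> space M)"
    proof (rule prob_le_superlevel_set[OF D B E_sets])
      show "emeasure lborel B < \<infinity>"
        using less by (simp add: less_le_trans[OF _ top_greatest])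
      show "emeasure lborel B \<le> emeasure lborel (E s)" using less by simp
      show "ennreal (g s) \<le> ennreal (g (Q (x - m)))" if "x \<in> E s" for x
        using that g s Q_nonneg by (intro ennreal_leI) (auto simp: E_def monotone_on_def)
      show "ennreal (g (Q (x - m))) \<le> ennreal (g s)" if "x \<notin> E s" for x
        using that g s Q_nonneg by (intro ennreal_leI) (auto simp: E_def monotone_on_def)
    qed
    also have "R -` E s \<inter> space M = {\<omega> \<in> space M. Q (R \<omega> - m) \<le> s}"
      by (auto simp: E_def)
    also have "prob \<dots> < 1 - \<alpha>"
      by (rule prob_le_below_upper_quantile) (use s \<alpha> in \<open>auto simp: Q_nonneg r_def\<close>)
    finally show False using prob_B by simp
  qed
  show ?thesis
  proof (cases "r = 0")
    \<comment> \<open>At level 0 no smaller nonnegative level is left, but the region is a single point.\<close>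
    case True
    have "E r \<subseteq> {m}"
    proof
      fix x assume "x \<in> E r"
      then have "Q (x - m) = 0" using True Q_nonneg[of "x - m"] by (simp add: E_def)
      from Q_zero[OF this] show "x \<in> {m}" by simp
    qed
    then have "emeasure lborel (E r) \<le> emeasure lborel {m}"
      by (intro emeasure_mono) auto
    then show ?thesis by (simp add: E_def r_def)
  next
    case False
    with r0 have r: "0 < r" by simp
    have scaled: "ennreal (a ^ DIM('b)) * emeasure lborel (E r) \<le> emeasure lborel B"
      if a: "0 < a" "a < 1" for a
    proof -
      \<comment> \<open>Shrinking by the factor \<open>a\<close> towards the centre \<open>m\<close> lowers the level by \<open>a\<^sup>2\<close>.\<close>
      have "E (a\<^sup>2 * r) = (\<lambda>x. a *\<^sub>R x + (m - a *\<^sub>R m)) ` E r"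
      proof (intro set_eqI iffI)
        fix z assume z: "z \<in> E (a\<^sup>2 * r)"
        define x where "x = m + (1 / a) *\<^sub>R (z - m)"
        have "Q (x - m) = (1 / a)\<^sup>2 * Q (z - m)"
          by (simp add: x_def Q_scale)
        then have "a\<^sup>2 * Q (x - m) \<le> a\<^sup>2 * r"
          using z a by (simp add: E_def power_divide)
        then have "x \<in> E r"
          using a by (simp add: E_def mult_le_cancel_left_pos)
        moreover have "z = a *\<^sub>R x + (m - a *\<^sub>R m)"
          using a by (simp add: x_def algebra_simps)
        ultimately show "z \<in> (\<lambda>x. a *\<^sub>R x + (m - a *\<^sub>R m)) ` E r" by blast
      next
        fix z assume "z \<in> (\<lambda>x. a *\<^sub>R x + (m - a *\<^sub>R m)) ` E r"
        then obtain x where x: "x \<in> E r" "z - m = a *\<^sub>R (x - m)"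
          by (auto simp: algebra_simps)
        then show "z \<in> E (a\<^sup>2 * r)"
          using a by (simp add: E_def Q_scale)
      qed
      then have "emeasure lebesgue (E (a\<^sup>2 * r)) = ennreal (a ^ DIM('b)) * emeasure lebesgue (E r)"
        using emeasure_lebesgue_affine[of a "m - a *\<^sub>R m" "E r"] a by (simp add: ennreal_power)
      then have "emeasure lborel (E (a\<^sup>2 * r)) = ennreal (a ^ DIM('b)) * emeasure lborel (E r)"
        by (simp add: E_sets)
      moreover have "a\<^sup>2 * r < r"
        using a r by (simp add: power_less_one_iff)
      ultimately show ?thesis
        using shrunk[of "a\<^sup>2 * r"] r by simp
    qed
    have "((\<lambda>a. ennreal (a ^ DIM('b))) \<longlongrightarrow> ennreal (1 ^ DIM('b))) (at_left 1)"
      by (intro tendsto_intros)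
    then have "((\<lambda>a. ennreal (a ^ DIM('b)) * emeasure lborel (E r)) \<longlongrightarrow>
        ennreal (1 ^ DIM('b)) * emeasure lborel (E r)) (at_left 1)"
      by (intro tendsto_mult_ennreal tendsto_const) auto
    moreover have "eventually (\<lambda>a. ennreal (a ^ DIM('b)) * emeasure lborel (E r)
        \<le> emeasure lborel B) (at_left 1)"
      using scaled by (auto simp: eventually_at_left[of 0 "1::real"] intro!: exI[of _ 0])
    ultimately have "ennreal (1 ^ DIM('b)) * emeasure lborel (E r) \<le> emeasure lborel B"
      by (rule tendsto_upperbound) simp
    then show ?thesis by (simp add: E_def r_def)
  qed
qed

section \<open>The centre of a symmetric distribution\<close>

text \<open>The reflection \<open>x \<mapsto> 2\<mu> - x\<close> preserves Lebesgue measure and the density, hence the law of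
  \<open>R\<close>; so the mean is a fixed point of the reflection.\<close>

lemma expectation_symmetric_density:
  fixes R :: "'a \<Rightarrow> 'b::euclidean_space"
  assumes D: "distributed M lborel R f" and int: "integrable M R"
    and sym: "\<And>v. f (\<mu> - v) = f (\<mu> + v)"
  shows "expectation R = \<mu>"
proof -
  define h :: "'b \<Rightarrow> 'b" where "h x = 2 *\<^sub>R \<mu> - x" for x
  have [measurable]: "f \<in> borel_measurable borel" "R \<in> borel_measurable M"
    and distr: "distr M lborel R = density lborel f"
    using D by (auto simp: distributed_def)
  have [measurable]: "h \<in> borel_measurable borel" unfolding h_def by simp
  have "(\<lambda>x. 2 *\<^sub>R \<mu> + (-1) *\<^sub>R x) = h" by (auto simp: h_def)
  then have refl: "distr lborel borel h = (lborel :: 'b measure)"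
    using lborel_affine[of "-1" "2 *\<^sub>R \<mu>"] by (simp add: density_1)
  have fh: "f (h x) = f x" for x
    using sym[of "x - \<mu>"] by (simp add: h_def algebra_simps scaleR_2)
  have "density lborel f = density (distr lborel borel h) f"
    by (simp add: refl)
  also have "\<dots> = distr (density lborel f) borel h"
    by (simp add: density_distr fh)
  finally have inv: "density lborel f = distr (density lborel f) borel h" .
  have "expectation R = (\<integral>x. x \<partial>density lborel f)"
    unfolding distr[symmetric] by (simp add: integral_distr)
  also have "\<dots> = (\<integral>x. h x \<partial>density lborel f)"
    by (subst inv) (simp add: integral_distr)
  also have "\<dots> = expectation (\<lambda>\<omega>. h (R \<omega>))"
    unfolding distr[symmetric] by (simp add: integral_distr)
  also have "\<dots> = 2 *\<^sub>R \<mu> - expectation R"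
    unfolding h_def using int by (simp add: prob_space)
  finally have "2 *\<^sub>R expectation R = 2 *\<^sub>R \<mu>"
    by (simp add: scaleR_2 eq_diff_eq)
  then show ?thesis by simp
qed

end

section \<open>Ellipsoids and quadratic forms\<close>

text \<open>The ellipsoid is the preimage of the ball under the affine map
  \<open>x\<^sub>i \<mapsto> \<surd>\<delta>\<^sub>i (x\<^sub>i + s\<^sub>i)\<close>, whose determinant is \<open>\<surd>(\<Prod>\<delta>\<^sub>i) = 1\<close>.\<close>

lemma emeasure_unit_determinant_ellipsoid:
  fixes s \<delta> :: "real ^ 'n"
  assumes pos: "\<And>i. 0 \<le> \<delta> $ i" and prod: "(\<Prod>i\<in>UNIV. \<delta> $ i) = 1"
  shows "emeasure lborel {x. (\<Sum>i\<in>UNIV. \<delta> $ i * (x $ i + s $ i)\<^sup>2) \<le> t}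
       = emeasure lborel {x :: real ^ 'n. (norm x)\<^sup>2 \<le> t}"
proof -
  define c :: "real ^ 'n \<Rightarrow> real" where "c j = sqrt (\<delta> \<bullet> j)" for j
  define a :: "real ^ 'n" where "a = (\<chi> i. sqrt (\<delta> $ i) * s $ i)"
  define \<phi> where "\<phi> x = a + (\<Sum>j\<in>Basis. (c j * (x \<bullet> j)) *\<^sub>R j)" for x
  have Basis: "(Basis :: (real ^ 'n) set) = (\<lambda>i. axis i 1) ` UNIV"
    by (auto simp: Basis_vec_def)
  have inj: "inj (\<lambda>i::'n. axis i (1::real))"
    by (auto simp: inj_on_def axis_eq_axis)
  have nz: "\<delta> $ i \<noteq> 0" for i
    using prod by (metis UNIV_I finite prod_zero_iff zero_neq_one)
  have c_nz: "c j \<noteq> 0" if "j \<in> Basis" for j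
    using that nz by (auto simp: c_def Basis cart_eq_inner_axis[symmetric])
  have "(\<Prod>j\<in>Basis. \<bar>c j\<bar>) = (\<Prod>i\<in>UNIV. sqrt (\<delta> $ i))"
    unfolding Basis
    by (subst prod.reindex[OF inj]) (simp add: c_def cart_eq_inner_axis[symmetric] pos)
  also have "\<dots> = sqrt (\<Prod>i\<in>UNIV. \<delta> $ i)"
    by (induction rule: finite_induct[OF finite[of UNIV]]) (auto simp: real_sqrt_mult)
  finally have "(\<Prod>j\<in>Basis. \<bar>c j\<bar>) = 1" using prod by simp
  then have lb: "lborel = distr lborel borel \<phi>"
    using lborel_affine_euclidean[where c = c and t = a, OF c_nz]
    by (simp add: \<phi>_def[abs_def] density_1)
  have "\<phi> x $ i = sqrt (\<delta> $ i) * (x $ i + s $ i)" for x i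
  proof -
    have "\<phi> x $ i = a $ i + (\<Sum>j\<in>UNIV. c (axis j 1) * (x \<bullet> axis j 1) * axis j 1 $ i)"
      unfolding \<phi>_def Basis by (subst sum.reindex[OF inj]) simp
    also have "\<dots> = a $ i + c (axis i 1) * (x \<bullet> axis i 1)"
      by (simp add: axis_def if_distrib sum.delta cong: if_cong)
    finally show ?thesis
      by (simp add: a_def c_def cart_eq_inner_axis[symmetric] algebra_simps)
  qed
  then have norm_\<phi>: "(norm (\<phi> x))\<^sup>2 = (\<Sum>i\<in>UNIV. \<delta> $ i * (x $ i + s $ i)\<^sup>2)" for x
    by (simp add: norm_vec_def L2_set_def sum_nonneg power_mult_distrib pos)
  have [measurable]: "\<phi> \<in> borel_measurable borel"
    unfolding \<phi>_def by simp
  have "emeasure lborel {x :: real ^ 'n. (norm x)\<^sup>2 \<le> t}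
      = emeasure lborel (\<phi> -` {x. (norm x)\<^sup>2 \<le> t})"
    by (subst lb, subst emeasure_distr) auto
  then show ?thesis by (simp add: norm_\<phi> vimage_def)
qed

text \<open>With \<open>w = A\<^sup>-\<^sup>1v\<close> the form is \<open>w \<bullet> Aw\<close>. Invertibility comes first, since
  \<open>matrix_inv\<close> is an unspecified choice on singular matrices.\<close>

lemma inv_quad_form_pos:
  fixes A :: "real ^ 'n ^ 'n"
  assumes A: "pos_def_matrix A" and "v \<noteq> 0"
  shows "0 < inv_quad_form A v"
proof -
  have "x = 0" if "A *v x = 0" for x
    using A that by (force simp: pos_def_matrix_def)
  then have "invertible A"
    by (simp add: invertible_left_inverse matrix_left_invertible_ker)
  then have "A ** matrix_inv A = mat 1"
    unfolding invertible_def matrix_inv_def by (rule someI2_ex) simp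
  then have *: "A *v (matrix_inv A *v v) = v"
    by (simp add: matrix_vector_mul_assoc)
  with \<open>v \<noteq> 0\<close> have "matrix_inv A *v v \<noteq> 0" by auto
  with A have "0 < (matrix_inv A *v v) \<bullet> (A *v (matrix_inv A *v v))"
    by (auto simp: pos_def_matrix_def)
  then show ?thesis by (simp add: * inv_quad_form_def inner_commute)
qed

lemma inv_quad_form_0 [simp]: "inv_quad_form A 0 = 0"
  by (simp add: inv_quad_form_def)

lemma inv_quad_form_scaleR: "inv_quad_form A (a *\<^sub>R v) = a\<^sup>2 * inv_quad_form A v"
  by (simp add: inv_quad_form_def matrix_vector_mult_scaleR power2_eq_square)

lemma inv_quad_form_measurable [measurable]: "inv_quad_form A \<in> borel_measurable borel"
  unfolding inv_quad_form_def by (intro borel_measurable_continuous_onI continuous_intros)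

section \<open>The two optimality statements\<close>

lemma (in prob_space) F_prob_le_ball:
  fixes T :: "'a \<Rightarrow> real ^ 'n" and g :: "real \<Rightarrow> real"
  assumes t: "0 < t" and g: "antimono_on {0..} g"
    and D: "distributed M lborel T (\<lambda>x. ennreal (g ((norm x)\<^sup>2)))"
    and \<delta>: "\<And>i. 0 \<le> \<delta> $ i" "(\<Prod>i\<in>UNIV. \<delta> $ i) = 1"
  shows "F_prob M T t s \<delta> \<le> F_prob M T t (\<chi> i. 0) (\<chi> i. 1)"
proof -
  define A where "A = {x :: real ^ 'n. (\<Sum>i\<in>UNIV. \<delta> $ i * (x $ i + s $ i)\<^sup>2) \<le> t}"
  define E where "E = {x :: real ^ 'n. (norm x)\<^sup>2 \<le> t}"
  have norm_sq: "(norm x)\<^sup>2 = (\<Sum>i\<in>UNIV. (x $ i)\<^sup>2)" for x :: "real ^ 'n"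
    by (simp add: norm_vec_def L2_set_def sum_nonneg)
  have A_sets: "A \<in> sets borel"
    unfolding A_def by (intro borel_closed closed_Collect_le continuous_intros)
  have E_sets: "E \<in> sets borel"
    unfolding E_def by measurable
  have "E = cball 0 (sqrt t)"
    using t by (auto simp: E_def real_le_rsqrt sqrt_ge_absD dest: power_mono)
  then have fin: "emeasure lborel E < \<infinity>"
    using emeasure_lborel_cball_finite[of "0 :: real ^ 'n" "sqrt t"] by simp
  have eq: "emeasure lborel A = emeasure lborel E"
    unfolding A_def E_def by (rule emeasure_unit_determinant_ellipsoid[OF \<delta>])
  have "prob (T -` A \<inter> space M) \<le> prob (T -` E \<inter> space M)"
    using g t fin eq
    by (intro prob_le_superlevel_set[OF D A_sets E_sets, where c = "ennreal (g t)"])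
       (auto simp: E_def monotone_on_def intro!: ennreal_leI)
  moreover have "T -` A \<inter> space M = {\<omega> \<in> space M. (\<Sum>i\<in>UNIV. \<delta> $ i * (T \<omega> $ i + s $ i)\<^sup>2) \<le> t}"
    by (auto simp: A_def)
  moreover have "T -` E \<inter> space M = {\<omega> \<in> space M. (\<Sum>i\<in>UNIV. (T \<omega> $ i)\<^sup>2) \<le> t}"
    by (auto simp: E_def norm_sq)
  ultimately show ?thesis by (simp add: F_prob_def)
qed

text \<open>The ellipsoid is the highest-density region of its coverage, and the ball competes with it
  because it has probability at least \<open>1 - \<alpha>\<close> by the choice of its radius.\<close>

lemma (in prob_space) asymptotic_ellipsoid_le_ball:
  fixes R :: "'a \<Rightarrow> real ^ 'm" and g :: "real \<Rightarrow> real"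
  assumes \<alpha>: "0 < \<alpha>" "\<alpha> < 1" and g: "antimono_on {0..} g"
    and int: "integrable M (\<lambda>\<omega>. (norm (R \<omega>))\<^sup>2)"
    and pd: "pos_def_matrix (covariance_matrix M R)" and c: "c > 0"
    and D: "distributed M lborel R
              (\<lambda>r. ennreal (c * g (inv_quad_form (covariance_matrix M R) (r - \<mu>))))"
  shows "emeasure lebesgue (asymptotic_ellipsoid M R \<alpha>)
         \<le> emeasure lebesgue (asymptotic_ball M R \<alpha>)"
proof -
  define Q where "Q = inv_quad_form (covariance_matrix M R)"
  define B where "B = asymptotic_ball M R \<alpha>"
  have [measurable]: "R \<in> borel_measurable M"
    using D by (simp add: distributed_def)
  have Q_meas: "Q \<in> borel_measurable borel" by (simp add: Q_def)
  note [measurable] = Q_meas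
  have Q_nonneg: "0 \<le> Q v" for v
    using inv_quad_form_pos[OF pd, of v] by (cases "v = 0") (auto simp: Q_def)
  have Q_zero: "Q v = 0 \<Longrightarrow> v = 0" for v
    using inv_quad_form_pos[OF pd, of v] by (auto simp: Q_def)
  have Q_scale: "Q (a *\<^sub>R v) = a\<^sup>2 * Q v" for a v
    by (simp add: Q_def inv_quad_form_scaleR)
  have intR: "integrable M R"
  proof (rule Bochner_Integration.integrable_bound)
    show "integrable M (\<lambda>\<omega>. 1 + (norm (R \<omega>))\<^sup>2)" using int by simp
    have "x \<le> 1 + x\<^sup>2" for x :: real
      using zero_le_power2[of "x - 1"] zero_le_power2[of x] unfolding power2_diff one_power2 mult_1_right by linarith
    then show "AE \<omega> in M. norm (R \<omega>) \<le> norm (1 + (norm (R \<omega>))\<^sup>2)" by simp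
  qed simp
  have mean: "expectation R = \<mu>"
  proof (rule expectation_symmetric_density[OF D intR])
    have "Q (- v) = Q v" for v using Q_scale[of "-1" v] by simp
    then show "ennreal (c * g (inv_quad_form (covariance_matrix M R) (\<mu> - v - \<mu>)))
        = ennreal (c * g (inv_quad_form (covariance_matrix M R) (\<mu> + v - \<mu>)))" for v
      by (simp add: Q_def)
  qed
  define q where "q = upper_quantile M \<alpha> (\<lambda>\<omega>. (norm (R \<omega>))\<^sup>2)"
  have q: "0 \<le> q" "1 - \<alpha> \<le> prob {\<omega> \<in> space M. (norm (R \<omega>))\<^sup>2 \<le> q}"
    unfolding q_def by (intro upper_quantile_nonneg prob_le_upper_quantile; simp add: \<alpha>)+
  have B: "B = cball 0 (sqrt q)" by (simp add: B_def asymptotic_ball_def q_def)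
  have "R -` B \<inter> space M = {\<omega> \<in> space M. (norm (R \<omega>))\<^sup>2 \<le> q}"
    using q(1) by (auto simp: B real_le_rsqrt sqrt_ge_absD dest: power_mono)
  then have prob_B: "1 - \<alpha> \<le> prob (R -` B \<inter> space M)" using q(2) by simp
  have "emeasure lborel {z. Q (z - \<mu>) \<le> upper_quantile M \<alpha> (\<lambda>\<omega>. Q (R \<omega> - \<mu>))}
        \<le> emeasure lborel B"
  proof (rule highest_density_region_minimal_volume[where g = "\<lambda>u. c * g u"])
    show "distributed M lborel R (\<lambda>x. ennreal (c * g (Q (x - \<mu>))))"
      using D by (simp add: Q_def)
    show "antimono_on {0..} (\<lambda>u. c * g u)"
      using g c by (auto simp: monotone_on_def)
    show "B \<in> sets borel" by (simp add: B)
  qed (fact Q_meas Q_nonneg Q_zero Q_scale \<alpha> prob_B)+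
  moreover have "asymptotic_ellipsoid M R \<alpha> =
      {z. Q (z - \<mu>) \<le> upper_quantile M \<alpha> (\<lambda>\<omega>. Q (R \<omega> - \<mu>))}"
    by (simp add: asymptotic_ellipsoid_def Let_def Q_def mean)
  moreover have "{z. Q (z - \<mu>) \<le> upper_quantile M \<alpha> (\<lambda>\<omega>. Q (R \<omega> - \<mu>))} \<in> sets borel"
    by measurable
  moreover have "B \<in> sets borel" by (simp add: B)
  ultimately show ?thesis by (simp add: B_def[symmetric])
qed

theorem proposition4p7:
  shows
    "(\<forall>(M :: 'a measure) (T :: 'a \<Rightarrow> real ^ 'n) (g :: real \<Rightarrow> real) (t :: real).
        prob_space M \<and> t > 0 \<and>
        (\<forall>u\<ge>0. g u \<ge> 0) \<and> antimono_on {0..} g \<and>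
        distributed M lborel T (\<lambda>x. ennreal (g ((norm x)\<^sup>2)))
        \<longrightarrow> is_arg_max (\<lambda>(s, \<delta>). F_prob M T t s \<delta>)
              (\<lambda>(s, \<delta>). (\<forall>i. \<delta> $ i \<ge> 0) \<and> (\<Prod>i\<in>UNIV. \<delta> $ i) = 1)
              ((\<chi> i. 0), (\<chi> i. 1)))
     \<and>
     (\<forall>(M :: 'b measure) (R :: 'b \<Rightarrow> real ^ 'm) (g :: real \<Rightarrow> real)
        (\<mu> :: real ^ 'm) (\<Sigma> :: real ^ 'm ^ 'm) (\<alpha> :: real).
        prob_space M \<and> 0 < \<alpha> \<and> \<alpha> < 1 \<and>
        (\<forall>u\<ge>0. g u \<ge> 0) \<and> antimono_on {0..} g \<and>
        integrable M (\<lambda>\<omega>. (norm (R \<omega>))\<^sup>2) \<and>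
        \<Sigma> = covariance_matrix M R \<and> pos_def_matrix \<Sigma> \<and>
        (\<exists>c>0. distributed M lborel R (\<lambda>r. ennreal (c * g (inv_quad_form \<Sigma> (r - \<mu>)))))
        \<longrightarrow> emeasure lebesgue (asymptotic_ellipsoid M R \<alpha>)
              \<le> emeasure lebesgue (asymptotic_ball M R \<alpha>))"
proof (intro conjI allI impI; elim conjE exE)
  fix M :: "'a measure" and T :: "'a \<Rightarrow> real ^ 'n" and g :: "real \<Rightarrow> real" and t :: real
  assume "prob_space M" and t: "t > 0" and g: "antimono_on {0..} g"
    and D: "distributed M lborel T (\<lambda>x. ennreal (g ((norm x)\<^sup>2)))"
  interpret prob_space M by fact
  show "is_arg_max (\<lambda>(s, \<delta>). F_prob M T t s \<delta>)
      (\<lambda>(s, \<delta>). (\<forall>i. \<delta> $ i \<ge> 0) \<and> (\<Prod>i\<in>UNIV. \<delta> $ i) = 1) ((\<chi> i. 0), (\<chi> i. 1))"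
    using F_prob_le_ball[OF t g D] by (auto simp: is_arg_max_def not_less)
next
  fix M :: "'b measure" and R :: "'b \<Rightarrow> real ^ 'm" and g :: "real \<Rightarrow> real"
    and \<mu> :: "real ^ 'm" and \<Sigma> :: "real ^ 'm ^ 'm" and \<alpha> c :: real
  assume "prob_space M" "0 < \<alpha>" "\<alpha> < 1" "antimono_on {0..} g"
    "integrable M (\<lambda>\<omega>. (norm (R \<omega>))\<^sup>2)" "\<Sigma> = covariance_matrix M R" "pos_def_matrix \<Sigma>"
    "c > 0" "distributed M lborel R (\<lambda>r. ennreal (c * g (inv_quad_form \<Sigma> (r - \<mu>))))"
  then show "emeasure lebesgue (asymptotic_ellipsoid M R \<alpha>)
      \<le> emeasure lebesgue (asymptotic_ball M R \<alpha>)"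
    using prob_space.asymptotic_ellipsoid_le_ball by blast
qed

end
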